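(* Let $h:\mathbb{R}\to\mathbb{R}$ be any $m_h$-strongly convex and $L_h$-smooth function with $h'(0)=0$. Let $\sigma^*\in\mathcal F_{(a,b)}$ be an $(a,b)$-unbounded activation, let $\mathcal D$ be an $(L,R)$-well-behaved distribution on $\mathbb{R}^d$, and fix $x^*\in\mathbb{S}^{d-1}$. For $x\in\mathbb{S}^{d-1}$ let $$\sigma_h(\cdot;x,x^* )\in\operatorname*{argmin}_{\sigma\in L_2(\mathcal D_{x\cdot z})}\mathbb{E}_{z\sim\mathcal D}[h(\sigma(x\cdot z)-\sigma^*(x^*\cdot z))]$$ (minimizers understood up to $\mathcal D_{x\cdot z}$-a.e. equality). Consider the vector field $$g_h(x,x^* )=\mathbb{E}_{z\sim\mathcal D}[\partial_1\ell_h(x\cdot z,x^*\cdot z;x,x^* )\,z_{\perp x}],\qquad \ell_h(u,w;x,x^* )=\int_0^uh'(\sigma_h(s;x,x^* )-\sigma^*(w))\,ds,$$ where $\partial_1\ell_h(u,w;x,x^* )=h'(\sigma_h(u;x,x^* )-\sigma^*(w))$. Then, for any $x\in\mathbb{S}^{d-1}$ with $\theta(x,x^* )\in(0,\pi/2)$, $g_h(x,x^* )$ is $\mu$-RGA at $(x,x^* )$ with $$\mu=\frac{m_h}{L_h}\cdot\frac ab\cdot\frac{R^4L}{6}.$$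
   Context: $\mathbb{S}^{d-1}$ is the unit sphere of $\mathbb{R}^d$; $\theta(x,y)=\arccos(x\cdot y)$ for unit vectors; $z_{\perp x}=(I-xx^\top)z$; $\mathcal D_{x\cdot z}$ is the law of $x\cdot z$ for $z\sim\mathcal D$. Here $m_h,L_h>0$; $L_h$-smooth means differentiable with $L_h$-Lipschitz derivative. $(a,b)$-unbounded activations: for $0<a\le b$, $\mathcal F_{(a,b)}$ is the set of $\sigma:\mathbb{R}\to\mathbb{R}$ (Lipschitz) with $0\le\sigma'(s)\le b$ and $\sigma'(s)\ge a$ whenever $s>0$; at points of nondifferentiability the inequalities apply to all elements of the Clarke subdifferential. Well-behaved: for $L,R>0$, an isotropic distribution $\mathcal D$ on $\mathbb{R}^d$ ($\mathbb{E}[z]=0$, $\mathbb{E}[zz^\top]=I$) is $(L,R)$-well-behaved if for every orthonormal pair $x,v\in\mathbb{R}^d$ the random vector $(x\cdot z,v\cdot z)$ has a density $p_{x,v}$ with $p_{x,v}(s,t)\ge L$ for all $(s,t)\in[-R,R]^2$. A tangent vector $g(x)\perp x$ is $\mu$-RGA at $(x,x^* )$ if $g(x)\neq0$ whenever $x\neq x^*$ and $g(x)\cdot x^*\le-\mu\sin(\theta(x,x^* ))\|g(x)\|_2$. *)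

theory Defs
  imports "HOL-Probability.Probability"
begin

definition strongly_convex :: "real \<Rightarrow> (real \<Rightarrow> real) \<Rightarrow> bool" where
  "strongly_convex m h \<longleftrightarrow>
     (\<forall>s t u. 0 \<le> u \<and> u \<le> 1 \<longrightarrow>
        h (u * s + (1 - u) * t) \<le> u * h s + (1 - u) * h t - m / 2 * u * (1 - u) * (s - t)\<^sup>2)"

definition smooth_with :: "real \<Rightarrow> (real \<Rightarrow> real) \<Rightarrow> bool" where
  "smooth_with K h \<longleftrightarrow> (\<forall>s. h differentiable (at s)) \<and> K-lipschitz_on UNIV (deriv h)"

(* Clarke's generalized directional derivative: the limsup of
   (f (y + t * v) - f y) / t as y -> s (y = s allowed) and t -> 0+ . *)
definition clarke_dir_deriv :: "(real \<Rightarrow> real) \<Rightarrow> real \<Rightarrow> real \<Rightarrow> ereal" where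
  "clarke_dir_deriv f s v =
     Limsup (nhds s \<times>\<^sub>F at_right 0) (\<lambda>(y, t). ereal ((f (y + t * v) - f y) / t))"

definition clarke_subdiff :: "(real \<Rightarrow> real) \<Rightarrow> real \<Rightarrow> real set" where
  "clarke_subdiff f s = {\<xi>. \<forall>v. ereal (\<xi> * v) \<le> clarke_dir_deriv f s v}"

definition gen_deriv :: "(real \<Rightarrow> real) \<Rightarrow> real \<Rightarrow> real set" where
  "gen_deriv f s = (if f differentiable (at s) then {deriv f s} else clarke_subdiff f s)"

definition unbounded_activations :: "real \<Rightarrow> real \<Rightarrow> (real \<Rightarrow> real) set" where
  "unbounded_activations a b =
     {\<sigma>. (\<exists>C. C-lipschitz_on UNIV \<sigma>) \<and>
          (\<forall>s. \<forall>\<xi>\<in>gen_deriv \<sigma> s. 0 \<le> \<xi> \<and> \<xi> \<le> b \<and> (s > 0 \<longrightarrow> a \<le> \<xi>))}"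

definition isotropic :: "(real^'n) measure \<Rightarrow> bool" where
  "isotropic D \<longleftrightarrow>
     integrable D (\<lambda>z. z) \<and> (LINT z|D. z) = 0 \<and>
     (\<forall>i j. integrable D (\<lambda>z. z $ i * z $ j) \<and>
            (LINT z|D. z $ i * z $ j) = (mat 1 :: real^'n^'n) $ i $ j)"

definition well_behaved :: "real \<Rightarrow> real \<Rightarrow> (real^'n) measure \<Rightarrow> bool" where
  "well_behaved L R D \<longleftrightarrow>
     prob_space D \<and> sets D = sets borel \<and> isotropic D \<and>
     (\<forall>x v. norm x = 1 \<and> norm v = 1 \<and> x \<bullet> v = 0 \<longrightarrow>
        (\<exists>p :: real \<times> real \<Rightarrow> ennreal.
           distributed D lborel (\<lambda>z. (x \<bullet> z, v \<bullet> z)) p \<and>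
           (\<forall>s\<in>{-R..R}. \<forall>t\<in>{-R..R}. ennreal L \<le> p (s, t))))"

definition angle :: "real^'n \<Rightarrow> real^'n \<Rightarrow> real" where
  "angle x y = arccos (x \<bullet> y)"

definition proj_perp :: "real^'n \<Rightarrow> real^'n \<Rightarrow> real^'n" where
  "proj_perp x z = z - (x \<bullet> z) *\<^sub>R x"

definition marginal :: "(real^'n) measure \<Rightarrow> real^'n \<Rightarrow> real measure" where
  "marginal D x = distr D borel (\<lambda>z. x \<bullet> z)"

(* Functions, not classes: a minimizer below is any measurable representative
   of an element of the usual quotient space. *)
definition L2_space :: "'a measure \<Rightarrow> ('a \<Rightarrow> real) set" where
  "L2_space M = {f. f \<in> borel_measurable M \<and> integrable M (\<lambda>s. (f s)\<^sup>2)}"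

definition surrogate_minimizers ::
    "(real \<Rightarrow> real) \<Rightarrow> (real \<Rightarrow> real) \<Rightarrow> (real^'n) measure \<Rightarrow> real^'n \<Rightarrow> real^'n \<Rightarrow> (real \<Rightarrow> real) set"
  where
  "surrogate_minimizers h \<sigma>star D x xstar =
     {\<sigma>. is_arg_min (\<lambda>\<tau>. LINT z|D. h (\<tau> (x \<bullet> z) - \<sigma>star (xstar \<bullet> z)))
                    (\<lambda>\<tau>. \<tau> \<in> L2_space (marginal D x)) \<sigma>}"

definition loss ::
    "(real \<Rightarrow> real) \<Rightarrow> (real \<Rightarrow> real) \<Rightarrow> (real \<Rightarrow> real) \<Rightarrow> real \<Rightarrow> real \<Rightarrow> real" where
  "loss h \<sigma>star \<sigma> u w = (LBINT s=0..u. deriv h (\<sigma> s - \<sigma>star w))"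

(* The partial derivative of the loss in u is by convention its integrand at u; for a
   merely square-integrable sigma it need not be an actual derivative at every u. *)
definition d1_loss ::
    "(real \<Rightarrow> real) \<Rightarrow> (real \<Rightarrow> real) \<Rightarrow> (real \<Rightarrow> real) \<Rightarrow> real \<Rightarrow> real \<Rightarrow> real" where
  "d1_loss h \<sigma>star \<sigma> u w = deriv h (\<sigma> u - \<sigma>star w)"

lemma loss_has_derivative:
  assumes "smooth_with K h" and "continuous_on UNIV \<sigma>"
  shows "((\<lambda>u. loss h \<sigma>star \<sigma> u w) has_real_derivative d1_loss h \<sigma>star \<sigma> u w) (at u)"
proof -
  define c where "c = \<bar>u\<bar> + 1"
  have c: "- c < u" "u < c" "- c \<le> 0" "0 \<le> c"
    unfolding c_def by linarith+
  have "continuous_on UNIV (deriv h)"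
    using assms(1) lipschitz_on_continuous_on unfolding smooth_with_def by blast
  then have "continuous_on UNIV (\<lambda>s. deriv h (\<sigma> s - \<sigma>star w))"
    by (rule continuous_on_compose2) (auto intro!: continuous_intros assms(2))
  then have "continuous_on {-c..c} (\<lambda>s. deriv h (\<sigma> s - \<sigma>star w))"
    by (rule continuous_on_subset) simp
  from interval_integral_FTC2[OF c(3,4) this, of u] c
  have "((\<lambda>u. loss h \<sigma>star \<sigma> u w) has_vector_derivative d1_loss h \<sigma>star \<sigma> u w)
      (at u within {-c..c})"
    by (simp add: loss_def d1_loss_def zero_ereal_def)
  moreover have "at u within {-c..c} = at u"
    using c by (simp add: at_within_Icc_at)
  ultimately show ?thesis
    by (simp add: has_real_derivative_iff_has_vector_derivative)
qed

(* \<sigma>h x is the minimizer chosen at x. *)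
definition surrogate_field ::
    "(real \<Rightarrow> real) \<Rightarrow> (real \<Rightarrow> real) \<Rightarrow> (real^'n) measure \<Rightarrow> (real^'n \<Rightarrow> real \<Rightarrow> real) \<Rightarrow>
     real^'n \<Rightarrow> real^'n \<Rightarrow> real^'n" where
  "surrogate_field h \<sigma>star D \<sigma>h x xstar =
     (LINT z|D. d1_loss h \<sigma>star (\<sigma>h x) (x \<bullet> z) (xstar \<bullet> z) *\<^sub>R proj_perp x z)"

definition is_RGA :: "real \<Rightarrow> real^'n \<Rightarrow> real^'n \<Rightarrow> real^'n \<Rightarrow> bool" where
  "is_RGA \<mu> x xstar g \<longleftrightarrow>
     g \<bullet> x = 0 \<and> (x \<noteq> xstar \<longrightarrow> g \<noteq> 0) \<and>
     g \<bullet> xstar \<le> - \<mu> * sin (angle x xstar) * norm g"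

end

theory Submission
  imports Defs
begin

text \<open>
  Write \<open>x\<^sup>* = cs x + sn v\<close> with \<open>v\<close> a unit vector orthogonal to \<open>x\<close>, \<open>cs = cos \<theta>\<close> and
  \<open>sn = sin \<theta> > 0\<close>, and put \<open>s = x \<bullet> z\<close>, \<open>t = v \<bullet> z\<close>, \<open>w = x\<^sup>* \<bullet> z = cs s + sn t\<close>,
  \<open>f = h' (\<sigma>\<^sub>h s - \<sigma>\<^sup>* w)\<close>. Minimality of \<open>\<sigma>\<^sub>h\<close> says that \<open>f\<close> is orthogonal to every square-integrable
  function of \<open>s\<close> (\<open>arg_min_first_order\<close>). The field is \<open>g = E[f z\<^sub>\<perp>]\<close>, and both its norm and
  its component along \<open>x\<^sup>*\<close> are estimated through this orthogonality.

  Norm. By isotropy \<open>norm g\<^sup>2 \<le> E[f\<^sup>2]\<close>. Replacing \<open>w\<close> by \<open>cs s\<close> in \<open>f\<close> gives a function \<open>f\<^sub>0\<close> of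
  \<open>s\<close>, so \<open>E[f\<^sup>2] \<le> E[(f - f\<^sub>0)\<^sup>2]\<close>; as \<open>h'\<close> is \<open>L\<^sub>h\<close>-Lipschitz and \<open>\<sigma>\<^sup>*\<close> is \<open>b\<close>-Lipschitz, this
  is at most \<open>(L\<^sub>h b sn)\<^sup>2 E[t\<^sup>2] = (L\<^sub>h b sn)\<^sup>2\<close>.

  Component along \<open>x\<^sup>*\<close>. Orthogonality gives \<open>g \<bullet> x\<^sup>* = E[f w] = E[f (w - w\<^sub>0)]\<close> for every
  square-integrable function \<open>w\<^sub>0\<close> of \<open>s\<close>. If \<open>w\<^sub>0\<close> is the point where \<open>\<sigma>\<^sup>*\<close> takes the value
  \<open>\<sigma>\<^sub>h s\<close>, then \<open>f\<close> and \<open>w - w\<^sub>0\<close> have opposite signs, and for \<open>w \<ge> 0\<close> strong convexity of \<open>h\<close>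
  and the slope bound \<open>a\<close> on the positive axis yield
  \<open>- f (w - w\<^sub>0) \<ge> m\<^sub>h a (w - max w\<^sub>0 0)\<^sup>2\<close> (\<open>residual_gap\<close>). It then remains to bound the
  integral of \<open>(w - c s)\<^sup>2\<close> from below, for an arbitrary function \<open>c\<close>, over the half \<open>w \<ge> 0\<close> of the
  square where the density of \<open>(s, t)\<close> is at least \<open>L\<close>. For fixed \<open>s\<close>, a chord of length
  \<open>l\<close> contributes at least \<open>sn\<^sup>2 l\<^sup>3 / 12\<close>, the chords at \<open>s\<close> and \<open>-s\<close> have lengths that add up to \<open>2 R\<close>, and so convexity of the
  cube gives \<open>sn\<^sup>2 R\<^sup>4 / 6\<close> (\<open>half_square_second_moment\<close>). Hence
  \<open>g \<bullet> x\<^sup>* \<le> - m\<^sub>h a sn\<^sup>2 R\<^sup>4 L / 6\<close>, which together with the norm bound is the claim.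

  The point \<open>w\<^sub>0\<close> need not exist, nor be square-integrable in \<open>s\<close>. It is therefore clamped to
  \<open>[-N, N]\<close>; the sign argument then fails only for \<open>\<bar>w\<bar> > N\<close>, at a cost that vanishes as
  \<open>N \<longrightarrow> \<infinity>\<close> (\<open>residual_correlation_le\<close>).
\<close>

section \<open>Generalized derivatives and increments of activations\<close>

lemma Limsup_ge_along:
  fixes f :: "'a \<Rightarrow> ereal"
  assumes "filterlim g F G" "G \<noteq> bot" "\<forall>\<^sub>F x in G. c \<le> f (g x)"
  shows "c \<le> Limsup F f"
  unfolding Limsup_def
proof (rule INF_greatest)
  fix P assume "P \<in> {P. eventually P F}"
  then have "\<forall>\<^sub>F x in G. P (g x)"
    using assms(1) by (auto simp: filterlim_iff)
  with assms(3) have "\<forall>\<^sub>F x in G. P (g x) \<and> c \<le> f (g x)"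
    by eventually_elim auto
  with assms(2) obtain x where "P (g x)" "c \<le> f (g x)"
    using eventually_happens by blast
  then show "c \<le> Sup (f ` Collect P)"
    by (auto intro!: SUP_upper2[of "g x"])
qed

text \<open>
  The hypothesis says that \<open>f u - k u\<close> attains its minimum or maximum over \<open>[s, t]\<close> at the interior
  point \<open>c\<close>.
\<close>

lemma slope_in_clarke_subdiff_at_extremum:
  fixes f :: "real \<Rightarrow> real"
  assumes "s < c" "c < t"
    and extr: "(\<forall>u\<in>{s..t}. f c - k * c \<le> f u - k * u) \<or> (\<forall>u\<in>{s..t}. f u - k * u \<le> f c - k * c)"
  shows "k \<in> clarke_subdiff f c"
proof -
  have "ereal (k * v) \<le> clarke_dir_deriv f c v" for v
  proof -
    have lim: "((\<lambda>\<tau>. c + \<tau> * r) \<longlongrightarrow> c) (at_right 0)" for r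
    proof -
      have "((\<lambda>\<tau>. c + \<tau> * r) \<longlongrightarrow> c + 0 * r) (at_right 0)"
        by (intro tendsto_intros)
      then show ?thesis by simp
    qed
    have near: "\<forall>\<^sub>F \<tau> in at_right 0. c + \<tau> * r \<in> {s..t}" for r
      using topological_tendstoD[OF lim, of "{s<..<t}" r] assms(1,2)
      by (auto elim: eventually_mono)
    have pos: "\<forall>\<^sub>F \<tau>::real in at_right 0. 0 < \<tau>"
      by (simp add: eventually_at_right_less)
    from extr show ?thesis
    proof
      assume min: "\<forall>u\<in>{s..t}. f c - k * c \<le> f u - k * u"
      have "\<forall>\<^sub>F \<tau> in at_right 0. ereal (k * v) \<le> ereal ((f (c + \<tau> * v) - f c) / \<tau>)"
        using near[of v] pos
      proof eventually_elim
        case (elim \<tau>)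
        then have "f c - k * c \<le> f (c + \<tau> * v) - k * (c + \<tau> * v)"
          using min by blast
        with elim show ?case by (simp add: field_simps)
      qed
      moreover have "filterlim (\<lambda>\<tau>. (c, \<tau>)) (nhds c \<times>\<^sub>F at_right (0::real)) (at_right 0)"
        by (intro filterlim_Pair) (auto intro: filterlim_ident)
      ultimately show ?thesis
        unfolding clarke_dir_deriv_def
        by (intro Limsup_ge_along[where g = "\<lambda>\<tau>. (c, \<tau>)" and G = "at_right 0"]) auto
    next
      \<comment> \<open>At a maximum the base point moves: the quotient is taken from \<open>c - \<tau> v\<close> to \<open>c\<close>.\<close>
      assume max: "\<forall>u\<in>{s..t}. f u - k * u \<le> f c - k * c"
      have "\<forall>\<^sub>F \<tau> in at_right 0.
          ereal (k * v) \<le> ereal ((f ((c + \<tau> * (-v)) + \<tau> * v) - f (c + \<tau> * (-v))) / \<tau>)"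
        using near[of "-v"] pos
      proof eventually_elim
        case (elim \<tau>)
        then have "f (c + \<tau> * (-v)) - k * (c + \<tau> * (-v)) \<le> f c - k * c"
          using max by blast
        with elim show ?case by (simp add: field_simps)
      qed
      moreover have "filterlim (\<lambda>\<tau>. (c + \<tau> * (-v), \<tau>)) (nhds c \<times>\<^sub>F at_right (0::real)) (at_right 0)"
        by (intro filterlim_Pair lim filterlim_ident)
      ultimately show ?thesis
        unfolding clarke_dir_deriv_def
        by (intro Limsup_ge_along[where g = "\<lambda>\<tau>. (c + \<tau> * (-v), \<tau>)" and G = "at_right 0"]) auto
    qed
  qed
  then show ?thesis by (simp add: clarke_subdiff_def)
qed

text \<open>
  A form of Lebourg's mean value theorem on the line, by the argument of Rolle's theorem. It transfers
  bounds on generalized derivatives to difference quotients without differentiability almost everywhere.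
\<close>

lemma gen_deriv_mean_value:
  fixes f :: "real \<Rightarrow> real"
  assumes cont: "continuous_on UNIV f" and "s < t"
  obtains c where "s < c" "c < t" "(f t - f s) / (t - s) \<in> gen_deriv f c"
proof -
  define k where "k = (f t - f s) / (t - s)"
  define g where "g u = f u - k * u" for u
  have eq: "g s = g t"
    using \<open>s < t\<close> by (simp add: g_def k_def field_simps)
  have "continuous_on {s..t} g"
    unfolding g_def by (intro continuous_intros continuous_on_subset[OF cont]) auto
  then obtain p q where p: "p \<in> {s..t}" "\<forall>u\<in>{s..t}. g p \<le> g u"
      and q: "q \<in> {s..t}" "\<forall>u\<in>{s..t}. g u \<le> g q"
    using continuous_attains_inf[of "{s..t}" g] continuous_attains_sup[of "{s..t}" g] \<open>s < t\<close>
    by auto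
  have "\<exists>c. s < c \<and> c < t \<and> ((\<forall>u\<in>{s..t}. g c \<le> g u) \<or> (\<forall>u\<in>{s..t}. g u \<le> g c))"
  proof (cases "p \<in> {s<..<t} \<or> q \<in> {s<..<t}")
    case True then show ?thesis using p q by auto
  next
    case False
    then have "p \<in> {s, t}" "q \<in> {s, t}"
      using p(1) q(1) by auto
    then have const: "g u = g s" if "u \<in> {s..t}" for u
      using p(2) q(2) eq that by (auto intro: antisym)
    have mid: "s < (s + t) / 2" "(s + t) / 2 < t"
      using \<open>s < t\<close> by auto
    have "\<forall>u\<in>{s..t}. g ((s + t) / 2) \<le> g u"
    proof
      fix u assume "u \<in> {s..t}"
      then show "g ((s + t) / 2) \<le> g u"
        using const[of u] const[of "(s + t) / 2"] mid by simp
    qed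
    with mid show ?thesis by blast
  qed
  then obtain c where c: "s < c" "c < t"
      and extr: "(\<forall>u\<in>{s..t}. g c \<le> g u) \<or> (\<forall>u\<in>{s..t}. g u \<le> g c)"
    by blast
  have "k \<in> gen_deriv f c"
  proof (cases "f differentiable (at c)")
    case True
    then have "(f has_real_derivative deriv f c) (at c)"
      by (simp add: DERIV_deriv_iff_real_differentiable)
    then have der: "(g has_real_derivative deriv f c - k) (at c)"
      unfolding g_def by (auto intro!: derivative_eq_intros)
    define d where "d = min (c - s) (t - c)"
    have d: "0 < d" "\<And>u. \<bar>c - u\<bar> < d \<Longrightarrow> u \<in> {s..t}"
      using c by (auto simp: d_def)
    have "deriv f c - k = 0"
      using extr DERIV_local_min[OF der d(1)] DERIV_local_max[OF der d(1)] d(2) by blast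
    then show ?thesis by (simp add: gen_deriv_def True)
  next
    case False
    then show ?thesis
      using slope_in_clarke_subdiff_at_extremum[OF c extr[unfolded g_def]]
      by (simp add: gen_deriv_def)
  qed
  with c that show ?thesis by (simp add: k_def)
qed

lemma unbounded_activation_continuous:
  assumes "\<sigma> \<in> unbounded_activations a b"
  shows "continuous_on UNIV \<sigma>"
  using assms lipschitz_on_continuous_on unfolding unbounded_activations_def by blast

lemma unbounded_activation_increment:
  assumes \<sigma>: "\<sigma> \<in> unbounded_activations a b" and "r \<le> t"
  shows "0 \<le> \<sigma> t - \<sigma> r" and "\<sigma> t - \<sigma> r \<le> b * (t - r)"
    and "0 \<le> r \<Longrightarrow> a * (t - r) \<le> \<sigma> t - \<sigma> r"
proof -
  have "0 \<le> \<sigma> t - \<sigma> r \<and> \<sigma> t - \<sigma> r \<le> b * (t - r) \<and> (0 \<le> r \<longrightarrow> a * (t - r) \<le> \<sigma> t - \<sigma> r)"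
  proof (cases "r = t")
    case False
    with \<open>r \<le> t\<close> have "r < t" by simp
    from gen_deriv_mean_value[OF unbounded_activation_continuous[OF \<sigma>] this]
    obtain c where c: "r < c" "c < t" "(\<sigma> t - \<sigma> r) / (t - r) \<in> gen_deriv \<sigma> c" .
    then have "0 \<le> (\<sigma> t - \<sigma> r) / (t - r)" "(\<sigma> t - \<sigma> r) / (t - r) \<le> b"
        "0 < c \<longrightarrow> a \<le> (\<sigma> t - \<sigma> r) / (t - r)"
      using \<sigma> unfolding unbounded_activations_def by blast+
    with \<open>r < t\<close> c(1) show ?thesis by (auto simp: field_simps)
  qed simp
  then show "0 \<le> \<sigma> t - \<sigma> r" "\<sigma> t - \<sigma> r \<le> b * (t - r)"
    "0 \<le> r \<Longrightarrow> a * (t - r) \<le> \<sigma> t - \<sigma> r"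
    by auto
qed

lemma unbounded_activation_mono:
  "\<sigma> \<in> unbounded_activations a b \<Longrightarrow> mono \<sigma>"
  by (rule monoI) (use unbounded_activation_increment(1) in fastforce)

lemma unbounded_activation_abs_diff_le:
  assumes "\<sigma> \<in> unbounded_activations a b"
  shows "\<bar>\<sigma> t - \<sigma> r\<bar> \<le> b * \<bar>t - r\<bar>"
  using unbounded_activation_increment[OF assms, of r t]
    unbounded_activation_increment[OF assms, of t r]
  by (cases "r \<le> t") auto

section \<open>Smooth and strongly convex functions\<close>

lemma smooth_with_has_derivative:
  "smooth_with K h \<Longrightarrow> (h has_real_derivative deriv h s) (at s)"
  by (simp add: smooth_with_def DERIV_deriv_iff_real_differentiable)

lemma smooth_with_deriv_diff_le:
  "smooth_with K h \<Longrightarrow> \<bar>deriv h s - deriv h t\<bar> \<le> K * \<bar>s - t\<bar>"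
  unfolding smooth_with_def lipschitz_on_def by (auto simp: dist_real_def)

text \<open>The constant here is twice the optimal one, which is immaterial below.\<close>

lemma smooth_with_abs_taylor_le:
  assumes "smooth_with K h"
  shows "\<bar>h (s + d) - h s - d * deriv h s\<bar> \<le> K * d\<^sup>2"
proof -
  obtain \<xi> where \<xi>: "\<bar>\<xi> - s\<bar> \<le> \<bar>d\<bar>" "h (s + d) - h s = d * deriv h \<xi>"
  proof (cases "d = 0")
    case True then show ?thesis using that[of s] by simp
  next
    case False
    then consider "s < s + d" | "s + d < s" by linarith
    then show ?thesis
    proof cases
      case 1
      from MVT2[OF this smooth_with_has_derivative[OF assms]]
      obtain z where "s < z" "z < s + d" "h (s + d) - h s = d * deriv h z" by auto
      then show ?thesis using that[of z] by auto
    next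
      case 2
      from MVT2[OF this smooth_with_has_derivative[OF assms]]
      obtain z where z: "s + d < z" "z < s" "h s - h (s + d) = - d * deriv h z" by auto
      then have "h (s + d) - h s = d * deriv h z" by linarith
      then show ?thesis using that[of z] z by auto
    qed
  qed
  have K: "0 \<le> K"
    using assms unfolding smooth_with_def lipschitz_on_def by auto
  have "\<bar>h (s + d) - h s - d * deriv h s\<bar> = \<bar>d\<bar> * \<bar>deriv h \<xi> - deriv h s\<bar>"
    unfolding \<xi>(2) abs_mult[symmetric] by (simp add: algebra_simps)
  also have "\<dots> \<le> \<bar>d\<bar> * (K * \<bar>d\<bar>)"
    using smooth_with_deriv_diff_le[OF assms, of \<xi> s] mult_left_mono[OF \<xi>(1) K]
    by (intro mult_left_mono) auto
  also have "\<dots> = K * d\<^sup>2"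
    by (simp add: power2_eq_square mult.left_commute)
  finally show ?thesis .
qed

lemma strongly_convex_deriv_strongly_mono:
  assumes "strongly_convex m h" and "smooth_with K h"
  shows "m * (t - s)\<^sup>2 \<le> (deriv h t - deriv h s) * (t - s)"
proof -
  define k where "k u = h u - m / 2 * u\<^sup>2" for u
  have conv: "convex_on UNIV k"
  proof (rule convex_onI)
    fix u r q :: real assume "0 < u" "u < 1"
    then have "h (u * q + (1 - u) * r)
        \<le> u * h q + (1 - u) * h r - m / 2 * u * (1 - u) * (q - r)\<^sup>2"
      using assms(1) unfolding strongly_convex_def by (metis less_imp_le)
    then show "k ((1 - u) *\<^sub>R r + u *\<^sub>R q) \<le> (1 - u) * k r + u * k q"
      by (simp add: k_def field_simps power2_eq_square)
  qed simp
  have der: "(k has_real_derivative deriv h u - m * u) (at u)" for u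
    unfolding k_def using smooth_with_has_derivative[OF assms(2)]
    by (auto intro!: derivative_eq_intros)
  have "(deriv h s - m * s) * (t - s) \<le> k t - k s" "(deriv h t - m * t) * (s - t) \<le> k s - k t"
    by (intro convex_on_imp_above_tangent[OF conv]; simp add: der)+
  then show ?thesis
    by (simp add: power2_eq_square algebra_simps)
qed

lemma strongly_convex_deriv_bounds:
  assumes "strongly_convex m h" and "smooth_with K h" and "deriv h 0 = 0"
  shows "0 \<le> u \<Longrightarrow> m * u \<le> deriv h u" and "u \<le> 0 \<Longrightarrow> deriv h u \<le> m * u"
proof -
  have *: "(m * u) * u \<le> deriv h u * u"
    using strongly_convex_deriv_strongly_mono[OF assms(1,2), of u 0] assms(3)
    by (simp add: power2_eq_square mult.assoc)
  then show "m * u \<le> deriv h u" if "0 \<le> u"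
    using that assms(3) by (cases "u = 0") auto
  show "deriv h u \<le> m * u" if "u \<le> 0"
    using that assms(3) * by (cases "u = 0") auto
qed

section \<open>Generalized inverses and the pointwise residual estimate\<close>

text \<open>
  \<open>\<rho>\<close> is a generalized inverse of \<open>\<sigma>\<close> on \<open>[-N, N]\<close>. In the interior of the interval it
  satisfies \<open>\<sigma> (\<rho> y) = y\<close>, while at either end only one inequality survives. Monotonicity is what
  makes it Borel measurable.
\<close>

lemma clamped_inverse_exists:
  fixes \<sigma> :: "real \<Rightarrow> real"
  assumes cont: "continuous_on UNIV \<sigma>" and "mono \<sigma>" and "0 \<le> N"
  obtains \<rho> :: "real \<Rightarrow> real" where "mono \<rho>" and "\<And>y. \<rho> y \<in> {-N..N}"
    and "\<And>y. - N < \<rho> y \<Longrightarrow> \<sigma> (\<rho> y) \<le> y" and "\<And>y. \<rho> y < N \<Longrightarrow> y \<le> \<sigma> (\<rho> y)"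
proof -
  define A where "A y = {-N..N} \<inter> ({-N} \<union> {w. \<sigma> w \<le> y})" for y
  define \<rho> where "\<rho> y = Sup (A y)" for y
  have ne: "-N \<in> A y" for y
    using \<open>0 \<le> N\<close> by (simp add: A_def)
  have bdd: "bdd_above (A y)" for y
    by (rule bdd_aboveI[of _ N]) (simp add: A_def)
  have "closed (A y)" for y
    unfolding A_def
    by (intro closed_Int closed_Un closed_Collect_le cont continuous_intros)
  then have mem: "\<rho> y \<in> A y" for y
    unfolding \<rho>_def using ne bdd by (intro closed_contains_Sup) auto
  have upper: "w \<le> \<rho> y" if "w \<in> A y" for w y
    unfolding \<rho>_def using that bdd by (rule cSup_upper)
  show thesis
  proof
    show "mono \<rho>"
    proof (rule monoI)
      fix y y' :: real assume "y \<le> y'"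
      then have "A y \<subseteq> A y'" by (auto simp: A_def)
      then show "\<rho> y \<le> \<rho> y'" using mem upper by blast
    qed
    show "\<rho> y \<in> {-N..N}" for y
      using mem[of y] by (simp add: A_def)
    show "\<sigma> (\<rho> y) \<le> y" if "- N < \<rho> y" for y
      using mem[of y] that by (auto simp: A_def)
    show "y \<le> \<sigma> (\<rho> y)" if "\<rho> y < N" for y
    proof (rule ccontr)
      assume "\<not> y \<le> \<sigma> (\<rho> y)"
      then have less: "\<sigma> (\<rho> y) < y" by simp
      have "N \<notin> A y"
        using upper[of N y] that by auto
      then have "y < \<sigma> N"
        using \<open>0 \<le> N\<close> by (auto simp: A_def)
      with less that obtain w where w: "\<rho> y \<le> w" "w \<le> N" "\<sigma> w = y"
        using IVT'[of \<sigma> "\<rho> y" y N] continuous_on_subset[OF cont] by auto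
      then have "w \<in> A y"
        using mem[of y] by (auto simp: A_def)
      with upper[of w y] w less show False by auto
    qed
  qed
qed

text \<open>
  Here \<open>dh\<close> stands for \<open>h'\<close> and \<open>w0\<close> for the clamped inverse of \<open>\<sigma>\<close> at \<open>y\<close>. The truncation of
  \<open>w0\<close> at \<open>0\<close> in the second bound is needed because \<open>\<sigma>\<close> is known to grow on the positive axis only.
\<close>

lemma residual_gap:
  fixes dh \<sigma> :: "real \<Rightarrow> real"
  assumes m: "0 < m" and a: "0 < a"
    and dh: "\<And>u. 0 \<le> u \<Longrightarrow> m * u \<le> dh u" "\<And>u. u \<le> 0 \<Longrightarrow> dh u \<le> m * u"
    and mono: "mono \<sigma>"
    and growth: "\<And>r t. 0 \<le> r \<Longrightarrow> r \<le> t \<Longrightarrow> a * (t - r) \<le> \<sigma> t - \<sigma> r"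
    and w0: "- N < w0 \<Longrightarrow> \<sigma> w0 \<le> y" "w0 < N \<Longrightarrow> y \<le> \<sigma> w0"
    and w: "\<bar>w\<bar> \<le> N"
  shows "0 \<le> - (dh (y - \<sigma> w) * (w - w0))"
    and "0 \<le> w \<Longrightarrow> m * a * (w - max w0 0)\<^sup>2 \<le> - (dh (y - \<sigma> w) * (w - w0))"
proof -
  consider "w < w0" | "w = w0" | "w0 < w" by linarith
  then have "0 \<le> - (dh (y - \<sigma> w) * (w - w0)) \<and>
     (0 \<le> w \<longrightarrow> m * a * (w - max w0 0)\<^sup>2 \<le> - (dh (y - \<sigma> w) * (w - w0)))"
  proof cases
    case 1
    then have "\<sigma> w \<le> \<sigma> w0" "\<sigma> w0 \<le> y"
      using monoD[OF mono, of w w0] w0(1) w by auto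
    then have "m * (\<sigma> w0 - \<sigma> w) \<le> m * (y - \<sigma> w)" and le: "m * (y - \<sigma> w) \<le> dh (y - \<sigma> w)"
      and nn: "0 \<le> m * (y - \<sigma> w)"
      using m dh(1)[of "y - \<sigma> w"] by auto
    then have "m * (a * (w0 - w)) \<le> dh (y - \<sigma> w)" if "0 \<le> w"
      using mult_left_mono[OF growth[of w w0], of m] that 1 m by linarith
    then have "m * (a * (w0 - w)) * (w0 - w) \<le> dh (y - \<sigma> w) * (w0 - w)" if "0 \<le> w"
      using that 1 by (intro mult_right_mono) auto
    moreover have "0 \<le> dh (y - \<sigma> w) * (w0 - w)"
      using le nn 1 by (intro mult_nonneg_nonneg) auto
    ultimately show ?thesis
      using 1 by (auto simp: power2_eq_square algebra_simps max_def)
  next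
    case 2
    then show ?thesis by (simp add: max_def)
  next
    case 3
    then have *: "y \<le> \<sigma> w0" "\<sigma> w0 \<le> \<sigma> w"
      using monoD[OF mono, of w0 w] w0(2) w by auto
    then have le: "m * (\<sigma> w - y) \<le> - dh (y - \<sigma> w)"
      using dh(2)[of "y - \<sigma> w"] by (simp add: algebra_simps)
    have nn: "0 \<le> m * (\<sigma> w - y)"
      using * m by auto
    have "m * a * (w - max w0 0)\<^sup>2 \<le> - dh (y - \<sigma> w) * (w - w0)" if "0 \<le> w"
    proof -
      \<comment> \<open>If \<open>w0 < 0\<close>, the part of the increment of \<open>\<sigma>\<close> between \<open>w0\<close> and \<open>0\<close> is discarded.\<close>
      define c where "c = max w0 0"
      have c: "0 \<le> c" "c \<le> w" "w0 \<le> c"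
        using that 3 by (auto simp: c_def)
      have "a * (w - c) \<le> \<sigma> w - \<sigma> c"
        using growth c by blast
      also have "\<dots> \<le> \<sigma> w - y"
        using monoD[OF mono c(3)] * by linarith
      finally have "m * (a * (w - c)) \<le> m * (\<sigma> w - y)"
        using m by simp
      also note le
      finally have "m * (a * (w - c)) * (w - c) \<le> - dh (y - \<sigma> w) * (w - w0)"
        using c le nn by (intro mult_mono) auto
      then show ?thesis
        by (simp add: c_def power2_eq_square mult.assoc)
    qed
    moreover have "0 \<le> - dh (y - \<sigma> w) * (w - w0)"
      using le nn 3 by (intro mult_nonneg_nonneg) auto
    ultimately show ?thesis by auto
  qed
  then show "0 \<le> - (dh (y - \<sigma> w) * (w - w0))"
    and "0 \<le> w \<Longrightarrow> m * a * (w - max w0 0)\<^sup>2 \<le> - (dh (y - \<sigma> w) * (w - w0))"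
    by auto
qed

section \<open>Second moments over half of a square\<close>

text \<open>
  The slice of the half square at \<open>s\<close> contains the interval from \<open>-e\<close> to \<open>R\<close>, up to an end point
  when \<open>e = -R\<close>. Up to the factor \<open>sn\<^sup>2\<close> the bound is the second moment of an interval about
  its centre, where it is least.
\<close>

lemma nn_integral_square_half_cube_le:
  fixes e sn cs R c s :: real
  assumes R: "0 < R" and sn: "0 < sn" and e: "e = max (-R) (min R (cs / sn * s))"
  shows "ennreal (sn\<^sup>2 * (R + e) ^ 3 / 12) \<le>
    (\<integral>\<^sup>+t. ennreal (indicator {t. \<bar>t\<bar> \<le> R \<and> 0 \<le> cs * s + sn * t} t * (cs * s + sn * t - c)\<^sup>2) \<partial>lborel)"
proof (cases "e = - R")
  case True then show ?thesis by simp
next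
  case False
  then have e': "- R < e" "e \<le> R" "e \<le> cs / sn * s"
    using R by (auto simp: e)
  define F where "F t = (cs * s + sn * t - c) ^ 3 / (3 * sn)" for t
  have "sn\<^sup>2 * (R + e) ^ 3 / 12 \<le> F R - F (- e)"
  proof -
    define A B where "A = cs * s + sn * R - c" and "B = cs * s + sn * (- e) - c"
    have AB: "A - B = sn * (R + e)"
      by (simp add: A_def B_def algebra_simps)
    have "A ^ 3 - B ^ 3 - (A - B) ^ 3 / 4 = 3 / 4 * ((A - B) * (A + B)\<^sup>2)"
      by (simp add: power2_eq_square power3_eq_cube field_simps)
    also have "0 \<le> \<dots>"
      using AB sn e' R by (intro mult_nonneg_nonneg) auto
    finally have "(sn * (R + e)) ^ 3 / 4 \<le> A ^ 3 - B ^ 3"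
      using AB by simp
    then have "(sn * (R + e)) ^ 3 / 4 / (3 * sn) \<le> (A ^ 3 - B ^ 3) / (3 * sn)"
      using sn by (intro divide_right_mono) auto
    also have "\<dots> = F R - F (- e)"
      by (simp add: F_def A_def B_def diff_divide_distrib)
    also have "(sn * (R + e)) ^ 3 / 4 / (3 * sn) = sn\<^sup>2 * (R + e) ^ 3 / 12"
      using sn by (simp add: power_mult_distrib power2_eq_square power3_eq_cube)
    finally show ?thesis .
  qed
  then have "ennreal (sn\<^sup>2 * (R + e) ^ 3 / 12) \<le> ennreal (F R - F (- e))"
    by (rule ennreal_leI)
  also have "\<dots> = (\<integral>\<^sup>+t. ennreal ((cs * s + sn * t - c)\<^sup>2) * indicator {-e..R} t \<partial>lborel)"
  proof (rule nn_integral_FTC_Icc[symmetric])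
    show "(F has_real_derivative (cs * s + sn * t - c)\<^sup>2) (at t)" for t
      unfolding F_def using sn by (auto intro!: derivative_eq_intros simp: power2_eq_square field_simps)
  qed (use e' R in auto)
  also have "\<dots> \<le> (\<integral>\<^sup>+t. ennreal (indicator {t. \<bar>t\<bar> \<le> R \<and> 0 \<le> cs * s + sn * t} t
      * (cs * s + sn * t - c)\<^sup>2) \<partial>lborel)"
  proof (rule nn_integral_mono)
    fix t
    have "\<bar>t\<bar> \<le> R \<and> 0 \<le> cs * s + sn * t" if "- e \<le> t" "t \<le> R"
    proof
      show "\<bar>t\<bar> \<le> R" using that e' by simp
      have "sn * (- (cs / sn * s)) \<le> sn * t"
        using that e' sn by (intro mult_left_mono) auto
      then show "0 \<le> cs * s + sn * t" using sn by simp
    qed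
    then show "ennreal ((cs * s + sn * t - c)\<^sup>2) * indicator {-e..R} t
      \<le> ennreal (indicator {t. \<bar>t\<bar> \<le> R \<and> 0 \<le> cs * s + sn * t} t * (cs * s + sn * t - c)\<^sup>2)"
      by (auto simp: indicator_def)
  qed
  finally show ?thesis .
qed

text \<open>
  The part of the square \<open>[-R, R]\<^sup>2\<close> on the nonnegative side of the line \<open>cs s + sn t = 0\<close>
  through its centre.
\<close>

definition half_square :: "real \<Rightarrow> real \<Rightarrow> real \<Rightarrow> (real \<times> real) set" where
  "half_square R cs sn = {p. \<bar>fst p\<bar> \<le> R \<and> \<bar>snd p\<bar> \<le> R \<and> 0 \<le> cs * fst p + sn * snd p}"

lemma half_square_measurable [measurable]:
  "half_square R cs sn \<in> sets (borel \<Otimes>\<^sub>M borel)"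
proof -
  have "{p \<in> space (borel \<Otimes>\<^sub>M borel). \<bar>fst p\<bar> \<le> R \<and> \<bar>snd p\<bar> \<le> R \<and> 0 \<le> cs * fst p + sn * snd p}
      \<in> sets (borel \<Otimes>\<^sub>M borel)"
    by measurable
  then show ?thesis
    by (simp add: half_square_def space_pair_measure)
qed

text \<open>
  The constant does not depend on \<open>c\<close>. Since \<open>e\<close> is odd, reflecting \<open>s\<close> and averaging replaces the
  cube of the length of a slice by \<open>((R + e s)\<^sup>3 + (R - e s)\<^sup>3) / 2 \<ge> R\<^sup>3\<close>.
\<close>

lemma half_square_second_moment:
  fixes c :: "real \<Rightarrow> real"
  assumes R: "0 < R" and sn: "0 < sn" and [measurable]: "c \<in> borel_measurable borel"
  shows "ennreal (sn\<^sup>2 * (R ^ 4 / 6)) \<le>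
    (\<integral>\<^sup>+p. ennreal (indicator (half_square R cs sn) p
        * (cs * fst p + sn * snd p - c (fst p))\<^sup>2) \<partial>lborel)" (is "_ \<le> integral\<^sup>N lborel ?q")
proof -
  define e where "e s = max (-R) (min R (cs / sn * s))" for s
  define J where "J = (\<integral>\<^sup>+s. ennreal (sn\<^sup>2 * (R + e s) ^ 3 / 12) * indicator {-R..R} s \<partial>lborel)"
  have [measurable]: "e \<in> borel_measurable borel"
    unfolding e_def by measurable
  have odd: "e (- s) = - e s" for s
    using R by (auto simp: e_def max_def min_def)
  have bound: "- R \<le> e s" "e s \<le> R" for s
    using R by (auto simp: e_def)
  have reflect: "J = (\<integral>\<^sup>+s. ennreal (sn\<^sup>2 * (R - e s) ^ 3 / 12) * indicator {-R..R} s \<partial>lborel)"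
  proof -
    have "J = (\<integral>\<^sup>+s. ennreal (sn\<^sup>2 * (R + e s) ^ 3 / 12) * indicator {-R..R} s \<partial>distr lborel borel uminus)"
      unfolding J_def lborel_distr_uminus ..
    also have "\<dots> = (\<integral>\<^sup>+s. ennreal (sn\<^sup>2 * (R + e (- s)) ^ 3 / 12) * indicator {-R..R} (- s) \<partial>lborel)"
      by (rule nn_integral_distr) measurable
    also have "\<dots> = (\<integral>\<^sup>+s. ennreal (sn\<^sup>2 * (R - e s) ^ 3 / 12) * indicator {-R..R} s \<partial>lborel)"
      by (intro nn_integral_cong) (auto simp: odd indicator_def)
    finally show ?thesis .
  qed
  have "ennreal (2 * (sn\<^sup>2 * (R ^ 4 / 6))) = ennreal (sn\<^sup>2 * R ^ 3 / 6) * ennreal (2 * R)"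
    using R by (subst ennreal_mult[symmetric]) (auto simp: power_numeral_reduce)
  also have "\<dots> = (\<integral>\<^sup>+s. ennreal (sn\<^sup>2 * R ^ 3 / 6) * indicator {-R..R} s \<partial>lborel)"
    using R by (subst nn_integral_cmult_indicator) auto
  also have "\<dots> \<le> (\<integral>\<^sup>+s. ennreal (sn\<^sup>2 * (R + e s) ^ 3 / 12) * indicator {-R..R} s
      + ennreal (sn\<^sup>2 * (R - e s) ^ 3 / 12) * indicator {-R..R} s \<partial>lborel)"
  proof (rule nn_integral_mono)
    fix s
    have "2 * R ^ 3 \<le> (R + e s) ^ 3 + (R - e s) ^ 3"
      using R by (simp add: power3_eq_cube algebra_simps)
    then have "sn\<^sup>2 * (2 * R ^ 3) \<le> sn\<^sup>2 * ((R + e s) ^ 3 + (R - e s) ^ 3)"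
      by (intro mult_left_mono) auto
    then have "sn\<^sup>2 * R ^ 3 / 6 \<le> sn\<^sup>2 * (R + e s) ^ 3 / 12 + sn\<^sup>2 * (R - e s) ^ 3 / 12"
      by (simp add: algebra_simps)
    then show "ennreal (sn\<^sup>2 * R ^ 3 / 6) * indicator {-R..R} s
      \<le> ennreal (sn\<^sup>2 * (R + e s) ^ 3 / 12) * indicator {-R..R} s
        + ennreal (sn\<^sup>2 * (R - e s) ^ 3 / 12) * indicator {-R..R} s"
      using bound[of s]
      by (auto simp: indicator_def ennreal_plus[symmetric] simp del: ennreal_plus intro!: ennreal_leI)
  qed
  also have "\<dots> = J + (\<integral>\<^sup>+s. ennreal (sn\<^sup>2 * (R - e s) ^ 3 / 12) * indicator {-R..R} s \<partial>lborel)"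
    unfolding J_def by (rule nn_integral_add) measurable
  also have "\<dots> = J + J"
    unfolding reflect[symmetric] ..
  also have "\<dots> = ennreal 2 * J"
    by (simp only: ennreal_numeral mult_2)
  also have "ennreal (2 * (sn\<^sup>2 * (R ^ 4 / 6))) = ennreal 2 * ennreal (sn\<^sup>2 * (R ^ 4 / 6))"
    using R by (intro ennreal_mult) auto
  finally
 have "ennreal (sn\<^sup>2 * (R ^ 4 / 6)) \<le> J"
    by (simp add: ennreal_mult_le_mult_iff)
  also have "J \<le> (\<integral>\<^sup>+s. (\<integral>\<^sup>+t. ?q (s, t) \<partial>lborel) \<partial>lborel)"
    unfolding J_def
  proof (rule nn_integral_mono)
    fix s
    show "ennreal (sn\<^sup>2 * (R + e s) ^ 3 / 12) * indicator {-R..R} s \<le> (\<integral>\<^sup>+t. ?q (s, t) \<partial>lborel)"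
    proof (cases "s \<in> {-R..R}")
      case True
      then have "?q (s, t) = ennreal (indicator {t. \<bar>t\<bar> \<le> R \<and> 0 \<le> cs * s + sn * t} t
          * (cs * s + sn * t - c s)\<^sup>2)" for t
        by (auto simp: indicator_def half_square_def)
      then show ?thesis
        using True nn_integral_square_half_cube_le[OF R sn e_def, of s "c s"]
        by (simp only: indicator_simps mult_1_right)
    qed simp
  qed
  also have "\<dots> = integral\<^sup>N lborel ?q"
  proof -
    have "?q \<in> borel_measurable (lborel \<Otimes>\<^sub>M lborel)"
      by measurable
    then show ?thesis
      by (subst lborel.nn_integral_fst) (simp_all add: lborel_prod)
  qed
  finally show ?thesis .
qed

section \<open>Square-integrable functions\<close>

lemma L2_spaceD:
  assumes "f \<in> L2_space M"
  shows "f \<in> borel_measurable M" and "integrable M (\<lambda>x. (f x)\<^sup>2)"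
  using assms by (auto simp: L2_space_def)

lemma L2_space_dominated:
  assumes g: "g \<in> L2_space M" and f: "f \<in> borel_measurable M" and le: "\<And>x. \<bar>f x\<bar> \<le> \<bar>g x\<bar>"
  shows "f \<in> L2_space M"
proof -
  have "integrable M (\<lambda>x. (f x)\<^sup>2)"
  proof (rule Bochner_Integration.integrable_bound[OF L2_spaceD(2)[OF g]])
    show "(\<lambda>x. (f x)\<^sup>2) \<in> borel_measurable M"
      using f by measurable
    show "AE x in M. norm ((f x)\<^sup>2) \<le> norm ((g x)\<^sup>2)"
      using le by (auto simp: abs_le_square_iff[symmetric])
  qed
  with f show ?thesis by (simp add: L2_space_def)
qed

lemma L2_space_mult_integrable:
  assumes f: "f \<in> L2_space M" and g: "g \<in> L2_space M"
  shows "integrable M (\<lambda>x. f x * g x)"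
proof (rule Bochner_Integration.integrable_bound)
  show "integrable M (\<lambda>x. (f x)\<^sup>2 + (g x)\<^sup>2)"
    using L2_spaceD[OF f] L2_spaceD[OF g] by auto
  show "(\<lambda>x. f x * g x) \<in> borel_measurable M"
    using L2_spaceD[OF f] L2_spaceD[OF g] by auto
  have "\<bar>f x * g x\<bar> \<le> (f x)\<^sup>2 + (g x)\<^sup>2" for x
  proof -
    have "2 * \<bar>f x * g x\<bar> \<le> (f x)\<^sup>2 + (g x)\<^sup>2"
      using sum_squares_bound[of "\<bar>f x\<bar>" "\<bar>g x\<bar>"] by (simp add: abs_mult)
    then show ?thesis by linarith
  qed
  then show "AE x in M. norm (f x * g x) \<le> norm ((f x)\<^sup>2 + (g x)\<^sup>2)"
    by (intro AE_I2) simp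
qed

lemma L2_space_add:
  assumes f: "f \<in> L2_space M" and g: "g \<in> L2_space M"
  shows "(\<lambda>x. f x + g x) \<in> L2_space M"
proof -
  have "integrable M (\<lambda>x. (f x)\<^sup>2 + 2 * (f x * g x) + (g x)\<^sup>2)"
    using L2_spaceD[OF f] L2_spaceD[OF g] L2_space_mult_integrable[OF f g] by auto
  moreover have "(f x)\<^sup>2 + 2 * (f x * g x) + (g x)\<^sup>2 = (f x + g x)\<^sup>2" for x
    by (simp add: power2_sum)
  ultimately show ?thesis
    using L2_spaceD[OF f] L2_spaceD[OF g] by (simp add: L2_space_def)
qed

lemma L2_space_cmult:
  assumes "f \<in> L2_space M"
  shows "(\<lambda>x. c * f x) \<in> L2_space M"
  using L2_spaceD[OF assms] by (simp add: L2_space_def power_mult_distrib)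

lemma L2_space_diff:
  assumes "f \<in> L2_space M" and "g \<in> L2_space M"
  shows "(\<lambda>x. f x - g x) \<in> L2_space M"
  using L2_space_add[OF assms(1) L2_space_cmult[OF assms(2), of "-1"]] by simp

lemma (in finite_measure) L2_space_affine_growth:
  assumes g: "g \<in> L2_space M" and F: "F \<in> borel_measurable borel"
    and le: "\<And>u::real. \<bar>F u\<bar> \<le> A + K * \<bar>u\<bar>"
  shows "(\<lambda>x. F (g x)) \<in> L2_space M"
proof (rule L2_space_dominated)
  have [measurable]: "g \<in> borel_measurable M" "F \<in> borel_measurable borel"
    using L2_spaceD(1)[OF g] F by auto
  have "(\<lambda>x. \<bar>g x\<bar>) \<in> L2_space M"
    by (rule L2_space_dominated[OF g]) auto
  moreover have "(\<lambda>x. A) \<in> L2_space M"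
    by (simp add: L2_space_def)
  ultimately show "(\<lambda>x. A + K * \<bar>g x\<bar>) \<in> L2_space M"
    by (intro L2_space_add L2_space_cmult)
  show "(\<lambda>x. F (g x)) \<in> borel_measurable M"
    by measurable
  show "\<bar>F (g x)\<bar> \<le> \<bar>A + K * \<bar>g x\<bar>\<bar>" for x
    using le[of "g x"] by linarith
qed

lemma L2_space_distr_iff:
  assumes "X \<in> borel_measurable M" and "\<phi> \<in> borel_measurable borel"
  shows "\<phi> \<in> L2_space (distr M borel X) \<longleftrightarrow> (\<lambda>z. \<phi> (X z)) \<in> L2_space M"
  using assms by (simp add: L2_space_def integrable_distr_eq)

lemma L2_space_distrD:
  assumes "X \<in> borel_measurable M" and "\<phi> \<in> L2_space (distr M borel X)"
  shows "\<phi> \<in> borel_measurable borel" and "(\<lambda>z. \<phi> (X z)) \<in> L2_space M"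
proof -
  show "\<phi> \<in> borel_measurable borel"
    using L2_spaceD(1)[OF assms(2)] by simp
  then show "(\<lambda>z. \<phi> (X z)) \<in> L2_space M"
    using L2_space_distr_iff[OF assms(1)] assms(2) by blast
qed

section \<open>First-order condition and norm of the field\<close>

text \<open>
  The Euler equation of the minimization: perturbing \<open>\<sigma>\<close> by \<open>\<epsilon> \<phi>\<close> shows that
  \<open>\<epsilon> A + \<epsilon>\<^sup>2 B\<close> is nonnegative for all \<open>\<epsilon>\<close>, where \<open>A\<close> is the integral in the conclusion and
  \<open>B \<ge> 0\<close>; so \<open>A = 0\<close>. That \<open>h'\<close> is the derivative of \<open>h\<close> is expressed by the Taylor bound.
\<close>

lemma (in prob_space) arg_min_first_order:
  fixes h :: "real \<Rightarrow> real"
  assumes K: "0 \<le> K" and cont: "continuous_on UNIV h" and h'0: "h' 0 = 0" and [measurable]: "h' \<in> borel_measurable borel"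
    and lip: "\<And>s t. \<bar>h' s - h' t\<bar> \<le> K * \<bar>s - t\<bar>"
    and taylor: "\<And>s d. \<bar>h (s + d) - h s - d * h' s\<bar> \<le> K * d\<^sup>2"
    and X[measurable]: "X \<in> borel_measurable M" and Y: "Y \<in> L2_space M"
    and min: "is_arg_min (\<lambda>\<tau>. expectation (\<lambda>z. h (\<tau> (X z) - Y z)))
                (\<lambda>\<tau>. \<tau> \<in> L2_space (distr M borel X)) \<sigma>"
    and \<phi>: "\<phi> \<in> L2_space (distr M borel X)"
  shows "(\<lambda>z. h' (\<sigma> (X z) - Y z)) \<in> L2_space M"
    and "expectation (\<lambda>z. h' (\<sigma> (X z) - Y z) * \<phi> (X z)) = 0"
proof -
  have [measurable]: "h \<in> borel_measurable borel"
    using cont by (rule borel_measurable_continuous_onI)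
  define u where "u z = \<sigma> (X z) - Y z" for z
  define f where "f z = h' (u z)" for z
  have \<sigma>: "\<sigma> \<in> L2_space (distr M borel X)"
    using min by (simp add: is_arg_min_def)
  have u: "u \<in> L2_space M"
    unfolding u_def by (rule L2_space_diff[OF L2_space_distrD(2)[OF X \<sigma>] Y])
  have f: "f \<in> L2_space M"
    unfolding f_def using lip[of _ 0] h'0
    by (intro L2_space_affine_growth[OF u, where A = 0 and K = K]) auto
  then show "(\<lambda>z. h' (\<sigma> (X z) - Y z)) \<in> L2_space M"
    by (simp add: f_def[abs_def] u_def)
  have \<phi>X: "(\<lambda>z. \<phi> (X z)) \<in> L2_space M"
    by (rule L2_space_distrD(2)[OF X \<phi>])
  have h_int: "integrable M (\<lambda>z. h (w z))" if w: "w \<in> L2_space M" for w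
  proof (rule Bochner_Integration.integrable_bound)
    show "integrable M (\<lambda>z. \<bar>h 0\<bar> + K * (w z)\<^sup>2)"
      using L2_spaceD(2)[OF w] by auto
    show "(\<lambda>z. h (w z)) \<in> borel_measurable M"
      using L2_spaceD(1)[OF w] by measurable
    have "\<bar>h t\<bar> \<le> \<bar>h 0\<bar> + K * t\<^sup>2" for t
      using taylor[of 0 t] h'0 by simp
    then show "AE z in M. norm (h (w z)) \<le> norm (\<bar>h 0\<bar> + K * (w z)\<^sup>2)"
      using K by auto
  qed
  define A B where "A = expectation (\<lambda>z. f z * \<phi> (X z))" and "B = K * expectation (\<lambda>z. (\<phi> (X z))\<^sup>2)"
  have quad: "0 \<le> \<epsilon> * A + \<epsilon>\<^sup>2 * B" for \<epsilon>
  proof -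
    define \<tau> where "\<tau> s = \<sigma> s + \<epsilon> * \<phi> s" for s
    have \<tau>: "\<tau> \<in> L2_space (distr M borel X)"
      unfolding \<tau>_def by (intro L2_space_add L2_space_cmult \<sigma> \<phi>)
    then have \<tau>X: "(\<lambda>z. \<tau> (X z) - Y z) \<in> L2_space M"
      by (intro L2_space_diff[OF L2_space_distrD(2)[OF X] Y])
    have int: "integrable M (\<lambda>z. f z * \<phi> (X z))" "integrable M (\<lambda>z. (\<phi> (X z))\<^sup>2)"
      using L2_space_mult_integrable[OF f \<phi>X] L2_spaceD(2)[OF \<phi>X] by auto
    have "expectation (\<lambda>z. h (u z)) \<le> expectation (\<lambda>z. h (\<tau> (X z) - Y z))"
      using min \<tau> unfolding is_arg_min_def u_def by (metis not_less)
    also have "\<dots> \<le> expectation (\<lambda>z. h (u z) + (\<epsilon> * (f z * \<phi> (X z)) + K * \<epsilon>\<^sup>2 * (\<phi> (X z))\<^sup>2))"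
    proof (rule integral_mono)
      show "integrable M (\<lambda>z. h (\<tau> (X z) - Y z))"
        using h_int[OF \<tau>X] .
      show "integrable M (\<lambda>z. h (u z) + (\<epsilon> * (f z * \<phi> (X z)) + K * \<epsilon>\<^sup>2 * (\<phi> (X z))\<^sup>2))"
        using h_int[OF u] int by auto
      fix z
      have "\<tau> (X z) - Y z = u z + \<epsilon> * \<phi> (X z)"
        by (simp add: \<tau>_def u_def)
      then show "h (\<tau> (X z) - Y z) \<le> h (u z) + (\<epsilon> * (f z * \<phi> (X z)) + K * \<epsilon>\<^sup>2 * (\<phi> (X z))\<^sup>2)"
        using taylor[of "u z" "\<epsilon> * \<phi> (X z)"] by (simp add: f_def power_mult_distrib algebra_simps)
    qed
    also have "\<dots> = expectation (\<lambda>z. h (u z)) + (\<epsilon> * A + \<epsilon>\<^sup>2 * B)"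
      using h_int[OF u] int by (simp add: A_def B_def)
    finally show ?thesis by simp
  qed
  have "0 \<le> B"
    using K by (simp add: B_def)
  have "A = 0"
  proof (rule ccontr)
    assume "A \<noteq> 0"
    \<comment> \<open>This step makes \<open>\<epsilon> A + \<epsilon>\<^sup>2 B\<close> equal to \<open>-\<epsilon>\<^sup>2\<close>; the summand \<open>1\<close> covers \<open>B = 0\<close>.\<close>
    define \<epsilon> where "\<epsilon> = - A / (B + 1)"
    have A: "A = - \<epsilon> * (B + 1)"
      using \<open>0 \<le> B\<close> by (simp add: \<epsilon>_def)
    have "\<epsilon> * A + \<epsilon>\<^sup>2 * B = - \<epsilon>\<^sup>2"
      unfolding A by (simp add: power2_eq_square algebra_simps)
    moreover have "\<epsilon> \<noteq> 0"
      using \<open>A \<noteq> 0\<close> A by auto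
    ultimately show False
      using quad[of \<epsilon>] by simp
  qed
  then show "expectation (\<lambda>z. h' (\<sigma> (X z) - Y z) * \<phi> (X z)) = 0"
    by (simp add: A_def f_def u_def)
qed

text \<open>
  If \<open>f\<close> is orthogonal to \<open>f0\<close>, then \<open>f\<close> has at most the second moment of \<open>f - f0\<close>.
\<close>

lemma orthogonal_second_moment_le:
  fixes f f0 T :: "'a \<Rightarrow> real"
  assumes f: "f \<in> L2_space M" and f0: "f0 \<in> L2_space M" and T: "T \<in> L2_space M"
    and orth: "(LINT z|M. f z * f0 z) = 0" and le: "\<And>z. \<bar>f z - f0 z\<bar> \<le> C * \<bar>T z\<bar>"
  shows "(LINT z|M. (f z)\<^sup>2) \<le> C\<^sup>2 * (LINT z|M. (T z)\<^sup>2)"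
proof -
  have int: "integrable M (\<lambda>z. (f z)\<^sup>2)" "integrable M (\<lambda>z. (T z)\<^sup>2)"
      "integrable M (\<lambda>z. f z * f0 z)"
    using L2_spaceD(2) L2_space_mult_integrable f f0 T by blast+
  have "(LINT z|M. (f z)\<^sup>2) = (LINT z|M. (f z)\<^sup>2 - 2 * (f z * f0 z))"
    using int orth by simp
  also have "\<dots> \<le> (LINT z|M. C\<^sup>2 * (T z)\<^sup>2)"
  proof (rule integral_mono)
    show "integrable M (\<lambda>z. (f z)\<^sup>2 - 2 * (f z * f0 z))" "integrable M (\<lambda>z. C\<^sup>2 * (T z)\<^sup>2)"
      using int by auto
    fix z
    have "(f z)\<^sup>2 - 2 * (f z * f0 z) \<le> (f z - f0 z)\<^sup>2"
      by (simp add: power2_diff)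
    also have "\<dots> \<le> (C * \<bar>T z\<bar>)\<^sup>2"
      using power_mono[OF le[of z] abs_ge_zero, of 2] by simp
    finally show "(f z)\<^sup>2 - 2 * (f z * f0 z) \<le> C\<^sup>2 * (T z)\<^sup>2"
      by (simp add: power_mult_distrib)
  qed
  finally show ?thesis by simp
qed

lemma isotropic_inner_second_moment:
  fixes D :: "(real^'n) measure"
  assumes D: "isotropic D" "sets D = sets borel"
  shows "(\<lambda>z. u \<bullet> z) \<in> L2_space D" and "(LINT z|D. (u \<bullet> z)\<^sup>2) = (norm u)\<^sup>2"
proof -
  have eq: "(u \<bullet> z)\<^sup>2 = (\<Sum>i\<in>UNIV. \<Sum>j\<in>UNIV. u $ i * u $ j * (z $ i * z $ j))" for z :: "real^'n"
    by (simp add: inner_vec_def power2_eq_square sum_product mult_ac)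
  have int: "integrable D (\<lambda>z. z $ i * z $ j)"
    and mom: "(LINT z|D. z $ i * z $ j) = (if i = j then 1 else 0)" for i j
    using D(1) by (auto simp: isotropic_def mat_def)
  have "(\<lambda>z. u \<bullet> z) \<in> borel_measurable D"
    unfolding measurable_cong_sets[OF D(2) refl] by measurable
  moreover have "integrable D (\<lambda>z. (u \<bullet> z)\<^sup>2)"
    unfolding eq using int by auto
  ultimately show "(\<lambda>z. u \<bullet> z) \<in> L2_space D"
    by (simp add: L2_space_def)
  show "(LINT z|D. (u \<bullet> z)\<^sup>2) = (norm u)\<^sup>2"
    unfolding eq using int mom
    by (simp add: power2_norm_eq_inner inner_vec_def if_distrib[of "(*) _"] sum.If_cases cong: if_cong)
qed

lemma L2_scaled_proj_perp_integrable:
  fixes D :: "(real^'n) measure"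
  assumes D: "isotropic D" "sets D = sets borel" and x: "norm x = 1" and f: "f \<in> L2_space D"
  shows "integrable D (\<lambda>z. f z *\<^sub>R proj_perp x z)"
proof (rule Bochner_Integration.integrable_bound)
  have [measurable_cong]: "sets D = sets borel" by fact
  have "integrable D (\<lambda>z. (norm z)\<^sup>2)"
    using D(1) by (simp add: power2_norm_eq_inner inner_vec_def isotropic_def)
  then show "integrable D (\<lambda>z. (f z)\<^sup>2 + (norm z)\<^sup>2)"
    using L2_spaceD(2)[OF f] by auto
  show "(\<lambda>z. f z *\<^sub>R proj_perp x z) \<in> borel_measurable D"
    using L2_spaceD(1)[OF f] unfolding proj_perp_def by measurable
  have bound: "norm (f z *\<^sub>R proj_perp x z) \<le> (f z)\<^sup>2 + (norm z)\<^sup>2" for z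
  proof -
    have "norm (proj_perp x z) \<le> norm z + norm ((x \<bullet> z) *\<^sub>R x)"
      unfolding proj_perp_def by (rule norm_triangle_ineq4)
    also have "\<dots> \<le> 2 * norm z"
      using Cauchy_Schwarz_ineq2[of x z] x by simp
    finally have "norm (f z *\<^sub>R proj_perp x z) \<le> \<bar>f z\<bar> * (2 * norm z)"
      by (simp add: mult_left_mono)
    also have "\<dots> \<le> (f z)\<^sup>2 + (norm z)\<^sup>2"
      using sum_squares_bound[of "\<bar>f z\<bar>" "norm z"] by simp
    finally show ?thesis .
  qed
  show "AE z in D. norm (f z *\<^sub>R proj_perp x z) \<le> norm ((f z)\<^sup>2 + (norm z)\<^sup>2)"
    by (intro AE_I2 order_trans[OF bound]) simp
qed

lemma norm_L2_scaled_proj_perp_le: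
  fixes D :: "(real^'n) measure"
  assumes D: "isotropic D" "sets D = sets borel" and x: "norm x = 1" and f: "f \<in> L2_space D"
  defines "g \<equiv> LINT z|D. f z *\<^sub>R proj_perp x z"
  shows "g \<bullet> x = 0" and "(norm g)\<^sup>2 \<le> (LINT z|D. (f z)\<^sup>2)"
proof -
  have inner: "g \<bullet> w = (LINT z|D. f z * (proj_perp x z \<bullet> w))" for w
    unfolding g_def using L2_scaled_proj_perp_integrable[OF D x f]
    by (subst integral_inner_left[symmetric]) auto
  have "x \<bullet> x = 1"
    using x by (simp add: norm_eq_1)
  then have "proj_perp x z \<bullet> x = 0" for z
    by (simp add: proj_perp_def inner_diff_left inner_commute[of z x])
  then show gx: "g \<bullet> x = 0"
    by (simp add: inner)
  have L2: "(\<lambda>z. g \<bullet> z) \<in> L2_space D"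
    by (rule isotropic_inner_second_moment(1)[OF D])
  have "proj_perp x z \<bullet> g = g \<bullet> z" for z
    using gx by (simp add: proj_perp_def inner_diff_right inner_commute[of _ g])
  then have "(norm g)\<^sup>2 = (LINT z|D. f z * (g \<bullet> z))"
    unfolding power2_norm_eq_inner by (subst inner) simp
  also have "\<dots> \<le> (LINT z|D. (f z)\<^sup>2 / 2 + (g \<bullet> z)\<^sup>2 / 2)"
  proof (rule integral_mono)
    show "integrable D (\<lambda>z. f z * (g \<bullet> z))"
      by (rule L2_space_mult_integrable[OF f L2])
    show "integrable D (\<lambda>z. (f z)\<^sup>2 / 2 + (g \<bullet> z)\<^sup>2 / 2)"
      using L2_spaceD(2)[OF f] L2_spaceD(2)[OF L2] by auto
    show "f z * (g \<bullet> z) \<le> (f z)\<^sup>2 / 2 + (g \<bullet> z)\<^sup>2 / 2" for z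
      using sum_squares_bound[of "f z" "g \<bullet> z"] by simp
  qed
  also have "\<dots> = (LINT z|D. (f z)\<^sup>2) / 2 + (norm g)\<^sup>2 / 2"
    using L2_spaceD(2)[OF f] L2_spaceD(2)[OF L2] isotropic_inner_second_moment(2)[OF D, of g]
    by simp
  finally show "(norm g)\<^sup>2 \<le> (LINT z|D. (f z)\<^sup>2)" by simp
qed

section \<open>Correlation of the residual with the target direction\<close>

lemma (in prob_space) integral_tail_tendsto_zero:
  fixes g W :: "'a \<Rightarrow> real"
  assumes g: "integrable M g" and W[measurable]: "W \<in> borel_measurable M"
  shows "(\<lambda>n. expectation (\<lambda>z. \<bar>g z\<bar> * indicator {z. real n < \<bar>W z\<bar>} z)) \<longlonglongrightarrow> 0"
proof -
  have [measurable]: "g \<in> borel_measurable M"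
    using g by auto
  have ind: "indicator {z. real n < \<bar>W z\<bar>} z = (if real n < \<bar>W z\<bar> then 1 else (0::real))" for n z
    by simp
  have "(\<lambda>n. expectation (\<lambda>z. \<bar>g z\<bar> * indicator {z. real n < \<bar>W z\<bar>} z)) \<longlonglongrightarrow> expectation (\<lambda>_. 0)"
  proof (rule integral_dominated_convergence)
    show "integrable M (\<lambda>z. \<bar>g z\<bar>)"
      using g by auto
    show "(\<lambda>z. \<bar>g z\<bar> * indicator {z. real n < \<bar>W z\<bar>} z) \<in> borel_measurable M" for n
      unfolding ind by measurable
    show "AE z in M. norm (\<bar>g z\<bar> * indicator {z. real n < \<bar>W z\<bar>} z) \<le> \<bar>g z\<bar>" for n
      by (intro AE_I2) (simp add: indicator_def)
    show "AE z in M. (\<lambda>n. \<bar>g z\<bar> * indicator {z. real n < \<bar>W z\<bar>} z) \<longlonglongrightarrow> 0"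
    proof (intro AE_I2 tendsto_eventually)
      fix z
      have "\<forall>\<^sub>F n in sequentially. \<bar>W z\<bar> \<le> real n"
        using eventually_ge_at_top[of "nat \<lceil>\<bar>W z\<bar>\<rceil>"] by eventually_elim linarith
      then show "\<forall>\<^sub>F n in sequentially. \<bar>g z\<bar> * indicator {z. real n < \<bar>W z\<bar>} z = 0"
        by eventually_elim simp
    qed
  qed simp
  then show ?thesis by simp
qed

text \<open>
  \<open>S\<close>, \<open>T\<close>, \<open>W\<close>, \<open>f\<close> stand for \<open>s\<close>, \<open>t\<close>, \<open>w\<close> and the residual of the introduction, and \<open>\<eta>\<close> for
  the minimizer. \<open>G\<close> in the proof is \<open>- f (W - w0)\<close> plus \<open>2 \<bar>f W\<bar>\<close> where \<open>\<bar>W\<bar> > n\<close>; this term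
  keeps \<open>G\<close> nonnegative there, because \<open>\<bar>w0\<bar> \<le> n\<close> and so \<open>\<bar>W - w0\<bar> \<le> 2 \<bar>W\<bar>\<close>.
\<close>

lemma (in prob_space) residual_correlation_le:
  fixes S T :: "'a \<Rightarrow> real" and p :: "real \<times> real \<Rightarrow> ennreal" and \<eta> \<sigma> dh :: "real \<Rightarrow> real"
    and cs sn :: real
  defines "W \<equiv> \<lambda>z. cs * S z + sn * T z"
  defines "f \<equiv> \<lambda>z. dh (\<eta> (S z) - \<sigma> (W z))"
  assumes m: "0 < m" and a: "0 < a" and L: "0 < L" and R: "0 < R"
    and sn: "0 < sn" "sn \<le> 1" and cs: "\<bar>cs\<bar> \<le> 1"
    and dh: "\<And>u. 0 \<le> u \<Longrightarrow> m * u \<le> dh u" "\<And>u. u \<le> 0 \<Longrightarrow> dh u \<le> m * u"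
    and \<sigma>: "continuous_on UNIV \<sigma>" "mono \<sigma>"
    and growth: "\<And>r t. 0 \<le> r \<Longrightarrow> r \<le> t \<Longrightarrow> a * (t - r) \<le> \<sigma> t - \<sigma> r"
    and \<eta>[measurable]: "\<eta> \<in> borel_measurable borel"
    and S[measurable]: "S \<in> borel_measurable M"
    and W: "W \<in> L2_space M" and f: "f \<in> L2_space M"
    and dist: "distributed M lborel (\<lambda>z. (S z, T z)) p"
    and dens: "\<And>s t. s \<in> {-R..R} \<Longrightarrow> t \<in> {-R..R} \<Longrightarrow> ennreal L \<le> p (s, t)"
    and orth: "\<And>\<phi>. \<phi> \<in> borel_measurable borel \<Longrightarrow> (\<lambda>z. \<phi> (S z)) \<in> L2_space M \<Longrightarrow>
        expectation (\<lambda>z. f z * \<phi> (S z)) = 0"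
  shows "expectation (\<lambda>z. f z * W z) \<le> - (m * a * sn\<^sup>2 * (R ^ 4 * L / 6))"
proof -
  define \<kappa> where "\<kappa> = m * a * sn\<^sup>2 * (R ^ 4 * L / 6)"
  define tail where "tail n = expectation (\<lambda>z. \<bar>f z * W z\<bar> * indicator {z. real n < \<bar>W z\<bar>} z)" for n
  have fW: "integrable M (\<lambda>z. f z * W z)"
    by (rule L2_space_mult_integrable[OF f W])
  have [measurable]: "f \<in> borel_measurable M" "W \<in> borel_measurable M"
    using L2_spaceD(1)[OF f] L2_spaceD(1)[OF W] by auto
  have ind: "indicator {z. real n < \<bar>W z\<bar>} z = (if real n < \<bar>W z\<bar> then 1 else (0::real))" for n z
    by simp
  have bound: "\<kappa> \<le> - expectation (\<lambda>z. f z * W z) + 2 * tail n" if n: "2 * R \<le> real n" for n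
  proof -
    obtain \<rho> :: "real \<Rightarrow> real" where \<rho>: "mono \<rho>" "\<And>y. \<rho> y \<in> {- real n..real n}"
        "\<And>y. - real n < \<rho> y \<Longrightarrow> \<sigma> (\<rho> y) \<le> y" "\<And>y. \<rho> y < real n \<Longrightarrow> y \<le> \<sigma> (\<rho> y)"
      using clamped_inverse_exists[OF \<sigma>, of "real n"] by auto
    have [measurable]: "\<rho> \<in> borel_measurable borel"
      using \<rho>(1) by (rule borel_measurable_mono)
    define w0 where "w0 s = \<rho> (\<eta> s)" for s
    have [measurable]: "w0 \<in> borel_measurable borel"
      unfolding w0_def by measurable
    have w0: "\<bar>w0 s\<bar> \<le> real n" "- real n < w0 s \<Longrightarrow> \<sigma> (w0 s) \<le> \<eta> s" "w0 s < real n \<Longrightarrow> \<eta> s \<le> \<sigma> (w0 s)" for s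
      using \<rho>(2)[of "\<eta> s"] \<rho>(3,4) by (auto simp: w0_def)
    have w0S: "(\<lambda>z. w0 (S z)) \<in> L2_space M"
    proof (rule L2_space_dominated)
      show "(\<lambda>_. real n) \<in> L2_space M"
        by (simp add: L2_space_def)
      show "(\<lambda>z. w0 (S z)) \<in> borel_measurable M"
        by measurable
      show "\<bar>w0 (S z)\<bar> \<le> \<bar>real n\<bar>" for z
        using w0(1) by simp
    qed
    define c where "c s = max (w0 s) 0" for s
    have [measurable]: "c \<in> borel_measurable borel"
      unfolding c_def by measurable
    define q where "q p = indicator (half_square R cs sn) p * (cs * fst p + sn * snd p - c (fst p))\<^sup>2" for p
    define G where "G z = - (f z * W z) + f z * w0 (S z) + 2 * (\<bar>f z * W z\<bar> * indicator {z. real n < \<bar>W z\<bar>} z)" for z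
    have pointwise: "0 \<le> G z \<and> m * a * q (S z, T z) \<le> G z" for z
    proof (cases "\<bar>W z\<bar> \<le> real n")
      case True
      have "0 \<le> - (f z * (W z - w0 (S z)))"
          "0 \<le> W z \<Longrightarrow> m * a * (W z - max (w0 (S z)) 0)\<^sup>2 \<le> - (f z * (W z - w0 (S z)))"
        unfolding f_def using residual_gap[OF m a dh \<sigma>(2) growth w0(2,3) True] by auto
      moreover have "G z = - (f z * (W z - w0 (S z)))"
        using True by (simp add: G_def algebra_simps)
      ultimately show ?thesis
        by (auto simp: q_def c_def indicator_def half_square_def W_def)
    next
      case False
      \<comment> \<open>On the square \<open>\<bar>W\<bar> \<le> 2 R \<le> n\<close>; this is why \<open>n\<close> is taken at least \<open>2 R\<close>.\<close>
      have "(S z, T z) \<notin> half_square R cs sn"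
      proof
        assume "(S z, T z) \<in> half_square R cs sn"
        then have ST: "\<bar>S z\<bar> \<le> R" "\<bar>T z\<bar> \<le> R"
          by (auto simp: half_square_def)
        have "\<bar>cs * S z\<bar> \<le> 1 * R" "\<bar>sn * T z\<bar> \<le> 1 * R"
          unfolding abs_mult using cs sn ST by (intro mult_mono; simp)+
        with False n show False
          unfolding W_def by linarith
      qed
      moreover have "\<bar>f z * w0 (S z)\<bar> \<le> \<bar>f z * W z\<bar>"
        unfolding abs_mult using w0(1)[of "S z"] False by (intro mult_left_mono) auto
      ultimately show ?thesis
        using False by (auto simp: G_def q_def)
    qed
    have tail_int: "integrable M (\<lambda>z. \<bar>f z * W z\<bar> * indicator {z. real n < \<bar>W z\<bar>} z)"
    proof (rule Bochner_Integration.integrable_bound[OF fW])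
      show "(\<lambda>z. \<bar>f z * W z\<bar> * indicator {z. real n < \<bar>W z\<bar>} z) \<in> borel_measurable M"
        unfolding ind by measurable
    qed (intro AE_I2, simp add: indicator_def)
    then have G_int: "integrable M G"
      unfolding G_def using fW L2_space_mult_integrable[OF f w0S] by auto
    have q0: "0 \<le> q p" for p
      by (simp add: q_def)
    have "q \<in> borel_measurable (borel \<Otimes>\<^sub>M borel)"
      unfolding q_def by measurable
    then have [measurable]: "q \<in> borel_measurable borel"
      by (simp add: borel_prod)
    have "(\<lambda>z. (S z, T z)) \<in> borel_measurable M"
      using distributed_measurable[OF dist] by simp
    then have [measurable]: "(\<lambda>z. q (S z, T z)) \<in> borel_measurable M"
      by (rule measurable_compose) measurable
    have "ennreal (sn\<^sup>2 * (R ^ 4 * L / 6)) = ennreal L * ennreal (sn\<^sup>2 * (R ^ 4 / 6))"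
      using L by (subst ennreal_mult[symmetric]) (auto simp: mult_ac)
    also have "\<dots> \<le> ennreal L * (\<integral>\<^sup>+p. ennreal (q p) \<partial>lborel)"
      unfolding q_def using R sn by (intro mult_left_mono half_square_second_moment) auto
    also have "\<dots> = (\<integral>\<^sup>+p. ennreal L * ennreal (q p) \<partial>lborel)"
      by (rule nn_integral_cmult[symmetric]) measurable
    also have "\<dots> \<le> (\<integral>\<^sup>+r. p r * ennreal (q r) \<partial>lborel)"
    proof (rule nn_integral_mono)
      fix r :: "real \<times> real"
      show "ennreal L * ennreal (q r) \<le> p r * ennreal (q r)"
      proof (cases "r \<in> half_square R cs sn")
        case True
        then have "ennreal L \<le> p (fst r, snd r)"
          by (intro dens) (auto simp: half_square_def)
        then show ?thesis by (intro mult_right_mono) auto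
      qed (simp add: q_def)
    qed
    also have "\<dots> = (\<integral>\<^sup>+z. ennreal (q (S z, T z)) \<partial>M)"
      by (rule distributed_nn_integral[OF dist]) measurable
    finally have "ennreal (m * a) * ennreal (sn\<^sup>2 * (R ^ 4 * L / 6))
        \<le> ennreal (m * a) * (\<integral>\<^sup>+z. ennreal (q (S z, T z)) \<partial>M)"
      by (intro mult_left_mono) auto
    also have "\<dots> = (\<integral>\<^sup>+z. ennreal (m * a) * ennreal (q (S z, T z)) \<partial>M)"
      by (rule nn_integral_cmult[symmetric]) measurable
    also have "\<dots> \<le> (\<integral>\<^sup>+z. ennreal (G z) \<partial>M)"
      using pointwise m a q0
      by (intro nn_integral_mono) (simp add: ennreal_mult'[symmetric] ennreal_leI)
    also have "\<dots> = ennreal (expectation G)"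
      using pointwise by (intro nn_integral_eq_integral G_int) auto
    also have "ennreal (m * a) * ennreal (sn\<^sup>2 * (R ^ 4 * L / 6)) = ennreal \<kappa>"
      using m a L by (subst ennreal_mult[symmetric]) (auto simp: \<kappa>_def mult_ac)
    finally have "\<kappa> \<le> expectation G"
      using pointwise by (subst (asm) ennreal_le_iff) (auto intro!: integral_nonneg_AE)
    also have "expectation G = - expectation (\<lambda>z. f z * W z) + expectation (\<lambda>z. f z * w0 (S z)) + 2 * tail n"
      unfolding G_def tail_def
      using fW L2_space_mult_integrable[OF f w0S] tail_int by simp
    also have "expectation (\<lambda>z. f z * w0 (S z)) = 0"
      by (rule orth[OF _ w0S]) measurable
    finally show ?thesis by simp
  qed
  have "(\<lambda>n. - expectation (\<lambda>z. f z * W z) + 2 * tail n) \<longlonglongrightarrow> - expectation (\<lambda>z. f z * W z) + 2 * 0"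
    unfolding tail_def
    by (intro tendsto_intros integral_tail_tendsto_zero[OF fW]) auto
  moreover have "\<forall>\<^sub>F n in sequentially. \<kappa> \<le> - expectation (\<lambda>z. f z * W z) + 2 * tail n"
    using eventually_ge_at_top[of "nat \<lceil>2 * R\<rceil>"]
  proof eventually_elim
    case (elim n)
    then show ?case by (intro bound) linarith
  qed
  ultimately have "\<kappa> \<le> - expectation (\<lambda>z. f z * W z) + 2 * 0"
    by (intro tendsto_lowerbound) auto
  then show ?thesis by (simp add: \<kappa>_def)
qed

section \<open>Alignment of the surrogate field\<close>

theorem theorem5p26:
  fixes h \<sigma>star :: "real \<Rightarrow> real"
    and D :: "(real^'n) measure"
    and xstar :: "real^'n"
    and \<sigma>h :: "real^'n \<Rightarrow> real \<Rightarrow> real"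
    and m\<^sub>h L\<^sub>h a b L R :: real
  assumes "m\<^sub>h > 0" and "L\<^sub>h > 0"
    and "strongly_convex m\<^sub>h h" and "smooth_with L\<^sub>h h" and "deriv h 0 = 0"
    and "0 < a" and "a \<le> b" and "\<sigma>star \<in> unbounded_activations a b"
    and "L > 0" and "R > 0" and "well_behaved L R D"
    and "xstar \<in> sphere 0 1"
    and "\<And>x. x \<in> sphere 0 1 \<Longrightarrow> \<sigma>h x \<in> surrogate_minimizers h \<sigma>star D x xstar"
  shows "\<forall>x \<in> sphere 0 1. angle x xstar \<in> {0<..<pi/2} \<longrightarrow>
           is_RGA (m\<^sub>h / L\<^sub>h * (a / b) * (R ^ 4 * L / 6)) x xstar
             (surrogate_field h \<sigma>star D \<sigma>h x xstar)"
proof (intro ballI impI)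
  fix x :: "real^'n"
  assume "x \<in> sphere 0 1" and angle: "angle x xstar \<in> {0<..<pi/2}"
  then have x: "norm x = 1" and xstar: "norm xstar = 1"
    using \<open>xstar \<in> sphere 0 1\<close> by auto
  have D: "prob_space D" "isotropic D" "sets D = sets borel"
    using \<open>well_behaved L R D\<close> by (auto simp: well_behaved_def)
  interpret prob_space D by fact
  note smooth = \<open>smooth_with L\<^sub>h h\<close> and act = \<open>\<sigma>star \<in> unbounded_activations a b\<close>
  define cs sn where "cs = x \<bullet> xstar" and "sn = sin (angle x xstar)"
  have cs: "\<bar>cs\<bar> \<le> 1"
    using Cauchy_Schwarz_ineq2[of x xstar] x xstar by (simp add: cs_def)
  have "cos (angle x xstar) = cs"
    using cs by (auto simp: angle_def cs_def intro!: cos_arccos_abs)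
  then have sc: "sn\<^sup>2 = 1 - cs\<^sup>2"
    unfolding sn_def by (simp add: sin_squared_eq)
  have sn: "0 < sn" "sn \<le> 1"
    using angle pi_gt_zero by (auto simp: sn_def intro!: sin_gt_zero)
  define v where "v = (1 / sn) *\<^sub>R (xstar - cs *\<^sub>R x)"
  have xx: "x \<bullet> x = 1" "xstar \<bullet> xstar = 1"
    using x xstar by (simp_all add: norm_eq_1)
  have xv: "x \<bullet> v = 0"
    by (simp add: v_def inner_diff_right xx cs_def)
  have "v \<bullet> v = (1 / sn)\<^sup>2 * (1 - cs\<^sup>2)"
    by (simp add: v_def inner_diff_left inner_diff_right xx cs_def inner_commute[of xstar x] power2_eq_square)
  then have v: "norm v = 1"
    using sn by (simp add: norm_eq_1 sc[symmetric] power_divide)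
  have xstar_eq: "xstar \<bullet> z = cs * (x \<bullet> z) + sn * (v \<bullet> z)" for z
    using sn by (simp add: v_def inner_diff_left)
  have L2: "(\<lambda>z. u \<bullet> z) \<in> L2_space D" for u
    by (rule isotropic_inner_second_moment(1)[OF D(2,3)])
  note inner_meas [measurable] = L2_spaceD(1)[OF L2]

  have [measurable]: "deriv h \<in> borel_measurable borel"
    using smooth lipschitz_on_continuous_on unfolding smooth_with_def
    by (blast intro: borel_measurable_continuous_onI)
  have [measurable]: "\<sigma>star \<in> borel_measurable borel"
    by (intro borel_measurable_continuous_onI unbounded_activation_continuous[OF act])
  have h_cont: "continuous_on UNIV h"
    using DERIV_isCont[OF smooth_with_has_derivative[OF smooth]]
    by (simp add: continuous_at_imp_continuous_on)
  have star_L2: "(\<lambda>z. \<sigma>star (g z)) \<in> L2_space D" if "g \<in> L2_space D" for g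
  proof (rule L2_space_affine_growth[OF that])
    show "\<bar>\<sigma>star u\<bar> \<le> \<bar>\<sigma>star 0\<bar> + b * \<bar>u\<bar>" for u
      using unbounded_activation_abs_diff_le[OF act, of u 0] by simp
  qed measurable

  define \<sigma> where "\<sigma> = \<sigma>h x"
  define f where "f z = deriv h (\<sigma> (x \<bullet> z) - \<sigma>star (xstar \<bullet> z))" for z
  define g where "g = surrogate_field h \<sigma>star D \<sigma>h x xstar"
  have g_eq: "g = (LINT z|D. f z *\<^sub>R proj_perp x z)"
    by (simp add: g_def surrogate_field_def d1_loss_def f_def \<sigma>_def)
  have min: "is_arg_min (\<lambda>\<tau>. LINT z|D. h (\<tau> (x \<bullet> z) - \<sigma>star (xstar \<bullet> z)))
      (\<lambda>\<tau>. \<tau> \<in> L2_space (distr D borel (\<lambda>z. x \<bullet> z))) \<sigma>"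
    using assms(13)[OF \<open>x \<in> sphere 0 1\<close>]
    by (simp add: surrogate_minimizers_def marginal_def \<sigma>_def)
  note first_order = arg_min_first_order[OF less_imp_le[OF \<open>L\<^sub>h > 0\<close>] h_cont \<open>deriv h 0 = 0\<close> _
      smooth_with_deriv_diff_le[OF smooth] smooth_with_abs_taylor_le[OF smooth] inner_meas
      star_L2[OF L2] min]
  have \<sigma>_L2: "\<sigma> \<in> L2_space (distr D borel (\<lambda>z. x \<bullet> z))"
    using min by (simp add: is_arg_min_def)
  have \<sigma>_meas [measurable]: "\<sigma> \<in> borel_measurable borel"
    and \<sigma>x_L2: "(\<lambda>z. \<sigma> (x \<bullet> z)) \<in> L2_space D"
    using L2_space_distrD[OF inner_meas \<sigma>_L2] by auto
  have f_L2: "f \<in> L2_space D"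
    unfolding f_def using \<sigma>_L2 by (intro first_order(1)) measurable
  have orth: "(LINT z|D. f z * \<phi> (x \<bullet> z)) = 0"
    if "\<phi> \<in> borel_measurable borel" "(\<lambda>z. \<phi> (x \<bullet> z)) \<in> L2_space D" for \<phi>
    unfolding f_def using that L2_space_distr_iff[OF inner_meas that(1)]
    by (intro first_order(2)) auto

  have gx: "g \<bullet> x = 0" and "(norm g)\<^sup>2 \<le> (LINT z|D. (f z)\<^sup>2)"
    unfolding g_eq by (rule norm_L2_scaled_proj_perp_le[OF D(2,3) x f_L2])+
  \<comment> \<open>The residual with \<open>xstar \<bullet> z\<close> replaced by its part that depends on \<open>x \<bullet> z\<close> only.\<close>
  define f0 where "f0 s = deriv h (\<sigma> s - \<sigma>star (cs * s))" for s
  have [measurable]: "f0 \<in> borel_measurable borel"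
    unfolding f0_def by measurable
  have f0_L2: "(\<lambda>z. f0 (x \<bullet> z)) \<in> L2_space D"
    unfolding f0_def
  proof (rule L2_space_affine_growth[where F = "deriv h" and A = 0 and K = L\<^sub>h])
    show "(\<lambda>z. \<sigma> (x \<bullet> z) - \<sigma>star (cs * (x \<bullet> z))) \<in> L2_space D"
      by (intro L2_space_diff \<sigma>x_L2 star_L2 L2_space_cmult L2)
    show "\<bar>deriv h u\<bar> \<le> 0 + L\<^sub>h * \<bar>u\<bar>" for u
      using smooth_with_deriv_diff_le[OF smooth, of u 0] \<open>deriv h 0 = 0\<close> by simp
  qed measurable
  note \<open>(norm g)\<^sup>2 \<le> (LINT z|D. (f z)\<^sup>2)\<close>
  also have "(LINT z|D. (f z)\<^sup>2) \<le> (L\<^sub>h * b * sn)\<^sup>2 * (LINT z|D. (v \<bullet> z)\<^sup>2)"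
  proof (rule orthogonal_second_moment_le[OF f_L2 f0_L2 L2])
    show "(LINT z|D. f z * f0 (x \<bullet> z)) = 0"
      by (rule orth[OF _ f0_L2]) measurable
    fix z
    have "\<bar>f z - f0 (x \<bullet> z)\<bar> \<le> L\<^sub>h * \<bar>\<sigma>star (xstar \<bullet> z) - \<sigma>star (cs * (x \<bullet> z))\<bar>"
      unfolding f_def f0_def by (rule order_trans[OF smooth_with_deriv_diff_le[OF smooth]])
        (simp add: abs_minus_commute)
    also have "\<dots> \<le> L\<^sub>h * (b * \<bar>xstar \<bullet> z - cs * (x \<bullet> z)\<bar>)"
      using \<open>L\<^sub>h > 0\<close> by (intro mult_left_mono unbounded_activation_abs_diff_le[OF act]) auto
    also have "\<dots> = L\<^sub>h * b * sn * \<bar>v \<bullet> z\<bar>"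
      using sn by (simp add: xstar_eq abs_mult)
    finally show "\<bar>f z - f0 (x \<bullet> z)\<bar> \<le> L\<^sub>h * b * sn * \<bar>v \<bullet> z\<bar>" .
  qed
  also have "\<dots> = (L\<^sub>h * b * sn)\<^sup>2"
    using isotropic_inner_second_moment(2)[OF D(2,3), of v] v by simp
  finally have norm_g: "norm g \<le> L\<^sub>h * b * sn"
    by (rule power2_le_imp_le) (use \<open>L\<^sub>h > 0\<close> \<open>0 < a\<close> \<open>a \<le> b\<close> sn in auto)

  have "g \<bullet> xstar = (LINT z|D. f z *\<^sub>R proj_perp x z \<bullet> xstar)"
    unfolding g_eq using L2_scaled_proj_perp_integrable[OF D(2,3) x f_L2]
    by (subst integral_inner_left) auto
  also have "\<dots> = (LINT z|D. f z * (xstar \<bullet> z) - cs * (f z * (x \<bullet> z)))"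
    by (simp add: proj_perp_def inner_diff_left inner_commute[of _ xstar] cs_def algebra_simps)
  \<comment> \<open>Orthogonality applied to the identity function of \<open>x \<bullet> z\<close>.\<close>
  also have "\<dots> = (LINT z|D. f z * (xstar \<bullet> z))"
    using L2_space_mult_integrable[OF f_L2 L2] orth[of "\<lambda>s. s"] L2 by simp
  also have "\<dots> = (LINT z|D. f z * (cs * (x \<bullet> z) + sn * (v \<bullet> z)))"
    by (simp only: xstar_eq)
  also have "\<dots> \<le> - (m\<^sub>h * a * sn\<^sup>2 * (R ^ 4 * L / 6))"
  proof -
    obtain p where p: "distributed D lborel (\<lambda>z. (x \<bullet> z, v \<bullet> z)) p"
        "\<And>s t. s \<in> {-R..R} \<Longrightarrow> t \<in> {-R..R} \<Longrightarrow> ennreal L \<le> p (s, t)"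
      using \<open>well_behaved L R D\<close> x v xv unfolding well_behaved_def by blast
    have W: "(\<lambda>z. cs * (x \<bullet> z) + sn * (v \<bullet> z)) \<in> L2_space D"
      by (intro L2_space_add L2_space_cmult L2)
    have f_eq: "f = (\<lambda>z. deriv h (\<sigma> (x \<bullet> z) - \<sigma>star (cs * (x \<bullet> z) + sn * (v \<bullet> z))))"
      by (simp add: fun_eq_iff f_def xstar_eq)
    show ?thesis
      unfolding f_eq
      by (rule residual_correlation_le[OF \<open>m\<^sub>h > 0\<close> \<open>0 < a\<close> \<open>L > 0\<close> \<open>R > 0\<close> sn cs
            strongly_convex_deriv_bounds[OF \<open>strongly_convex m\<^sub>h h\<close> smooth \<open>deriv h 0 = 0\<close>]
            unbounded_activation_continuous[OF act] unbounded_activation_mono[OF act]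
            unbounded_activation_increment(3)[OF act] \<sigma>_meas inner_meas W
            f_L2[unfolded f_eq] p orth[unfolded f_eq]])
  qed
  finally have g_xstar: "g \<bullet> xstar \<le> - (m\<^sub>h * a * sn\<^sup>2 * (R ^ 4 * L / 6))" .

  define c where "c = R ^ 4 * L / 6"
  have pos: "0 < m\<^sub>h" "0 < L\<^sub>h" "0 < a" "0 < b" "0 < c" "0 < sn"
    using assms(1,2,6,7,9,10) sn by (auto simp: c_def)
  have "m\<^sub>h / L\<^sub>h * (a / b) * c * sn * norm g \<le> m\<^sub>h / L\<^sub>h * (a / b) * c * sn * (L\<^sub>h * b * sn)"
    using pos norm_g by (intro mult_left_mono) auto
  also have "\<dots> = m\<^sub>h * a * sn\<^sup>2 * c"
    using pos by (simp add: power2_eq_square)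
  finally have "g \<bullet> xstar \<le> - (m\<^sub>h / L\<^sub>h * (a / b) * c) * sn * norm g"
    using g_xstar unfolding c_def[symmetric] by simp
  moreover have "0 < m\<^sub>h * a * sn\<^sup>2 * c"
    using pos by simp
  then have "g \<noteq> 0"
    using g_xstar by (auto simp: c_def)
  ultimately show "is_RGA (m\<^sub>h / L\<^sub>h * (a / b) * (R ^ 4 * L / 6)) x xstar
      (surrogate_field h \<sigma>star D \<sigma>h x xstar)"
    using gx unfolding is_RGA_def c_def sn_def g_def by blast
qed

end
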